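(* Let $\Phi$ be a $k$-SAT instance on $n$ boolean variables $X(1),\dots,X(n)$, in which each clause is a disjunction of $k$ distinct literals and each variable appears in at most $L$ clauses, where $L\le\frac{2^k}{ek}$. Let $1\le j\le k$. Then the MT-distribution for $\Phi$ is $\epsilon$-approximately $j$-wise independent for $\epsilon=e\,L\,2^{-k}$.
   Context: A probability distribution on $\{0,1\}^n$ (with coordinates $X(1),\dots,X(n)$) is $\epsilon$-approximately $j$-wise independent if for all indices $1\le i_1<\dots<i_j\le n$ and all bits $y_1,\dots,y_j\in\{0,1\}$, $$\bigl|\Pr\bigl(X(i_1)=y_1\wedge\dots\wedge X(i_j)=y_j\bigr)-2^{-j}\bigr|\le\epsilon .$$ The MT-distribution for $\Phi$ is the distribution of the output of the Moser–Tardos algorithm: initially set $X(1),\dots,X(n)$ to independent uniform random bits; while some clause is violated, choose a violated clause (by an arbitrary fixed, possibly randomized, rule) and replace the values of all variables occurring in that clause with fresh independent uniform random bits. When $L\le 2^k/(ek)$ this terminates with probability one, at a satisfying assignment. The result holds for every choice of selection rule. Here $e$ is the base of the natural logarithm. *)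

theory Defs
  imports "HOL-Probability.Probability" "HOL-Probability.SPMF"
begin

text \<open>The literal \<open>(i, b)\<close> is the assertion \<open>X(i) = b\<close>. Variables are numbered \<open>1, \<dots>, n\<close>.\<close>

type_synonym assignment = "nat \<Rightarrow> bool"
type_synonym literal = "nat \<times> bool"
type_synonym clause = "literal set"

definition clause_vars :: "clause \<Rightarrow> nat set" where
  "clause_vars C = fst ` C"

definition satisfies :: "assignment \<Rightarrow> clause \<Rightarrow> bool" where
  "satisfies x C \<longleftrightarrow> (\<exists>(i, b)\<in>C. x i = b)"

definition violated :: "clause set \<Rightarrow> assignment \<Rightarrow> clause set" where
  "violated \<Phi> x = {C \<in> \<Phi>. \<not> satisfies x C}"

text \<open>Since a clause is a set, \<open>card C = k\<close> says that its \<open>k\<close> literals are distinct. A clause may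
  contain both literals of one variable; it is then never violated.\<close>

definition ksat_instance :: "nat \<Rightarrow> nat \<Rightarrow> clause set \<Rightarrow> bool" where
  "ksat_instance n k \<Phi> \<longleftrightarrow>
     (\<forall>C\<in>\<Phi>. finite C \<and> card C = k \<and> clause_vars C \<subseteq> {1..n})"

definition occurrences_at_most :: "nat \<Rightarrow> nat \<Rightarrow> clause set \<Rightarrow> bool" where
  "occurrences_at_most n L \<Phi> \<longleftrightarrow>
     (\<forall>i\<in>{1..n}. card {C \<in> \<Phi>. i \<in> clause_vars C} \<le> L)"

text \<open>Independent uniform bits on \<open>V\<close>; the function is \<open>False\<close> outside \<open>V\<close>, so that
  \<open>uniform_bits {1..n}\<close> is the uniform distribution on a copy of \<open>{0,1}\<^sup>n\<close>.\<close>

definition uniform_bits :: "nat set \<Rightarrow> assignment pmf" where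
  "uniform_bits V = Pi_pmf V False (\<lambda>_. bernoulli_pmf (1/2))"

definition resample :: "clause \<Rightarrow> assignment \<Rightarrow> assignment pmf" where
  "resample C x = map_pmf (\<lambda>y. override_on x y (clause_vars C)) (uniform_bits (clause_vars C))"

text \<open>A selection rule sees the whole past of the run, as the list (latest first) of pairs of an
  earlier assignment and the clause resampled there, together with the current assignment. It
  returns a distribution on clauses, so it may be randomized; what it does when no clause is
  violated is irrelevant.\<close>

type_synonym history = "(assignment \<times> clause) list"
type_synonym selection_rule = "history \<Rightarrow> assignment \<Rightarrow> clause pmf"

definition valid_rule :: "clause set \<Rightarrow> selection_rule \<Rightarrow> bool" where
  "valid_rule \<Phi> sel \<longleftrightarrow>
     (\<forall>h x. violated \<Phi> x \<noteq> {} \<longrightarrow> set_pmf (sel h x) \<subseteq> violated \<Phi> x)"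

text \<open>The loop is a least fixed point in the subprobability distributions; the mass missing from
  its total is the probability that it runs forever.\<close>

partial_function (spmf) mt_loop ::
  "clause set \<Rightarrow> selection_rule \<Rightarrow> history \<Rightarrow> assignment \<Rightarrow> assignment spmf" where
  "mt_loop \<Phi> sel h x =
     (if violated \<Phi> x = {} then return_spmf x
      else bind_spmf (spmf_of_pmf (sel h x)) (\<lambda>C.
           bind_spmf (spmf_of_pmf (resample C x)) (\<lambda>x'.
           mt_loop \<Phi> sel ((x, C) # h) x')))"

definition mt_output :: "nat \<Rightarrow> clause set \<Rightarrow> selection_rule \<Rightarrow> assignment spmf" where
  "mt_output n \<Phi> sel =
     bind_spmf (spmf_of_pmf (uniform_bits {1..n})) (\<lambda>x. mt_loop \<Phi> sel [] x)"

text \<open>\<open>D\<close> is the MT-distribution if it is the law of the output. As \<open>D\<close> is a probability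
  distribution, this includes that the algorithm terminates with probability one.\<close>

definition is_mt_distribution ::
  "nat \<Rightarrow> clause set \<Rightarrow> selection_rule \<Rightarrow> assignment pmf \<Rightarrow> bool" where
  "is_mt_distribution n \<Phi> sel D \<longleftrightarrow> mt_output n \<Phi> sel = spmf_of_pmf D"

definition approx_jwise_independent :: "nat \<Rightarrow> nat \<Rightarrow> real \<Rightarrow> assignment pmf \<Rightarrow> bool" where
  "approx_jwise_independent n j \<epsilon> D \<longleftrightarrow>
     (\<forall>i y. strict_mono_on {1..j} i \<and> i ` {1..j} \<subseteq> {1..n} \<longrightarrow>
        \<bar>measure_pmf.prob D {x. \<forall>l\<in>{1..j}. x (i l) = y l} - 1 / 2 ^ j\<bar> \<le> \<epsilon>)"

end

theory Submission
  imports Defs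
begin

text \<open>The proof is the witness-tree argument of Moser and Tardos in the language of heaps of pieces.
  For a target event \<open>R\<close> on a few variables, the clauses whose resampling influences the variables
  of \<open>R\<close> form a heap, and the sum over all heaps of the probability that a random table of bits is
  consistent with the heap, given the current assignment as its first row, is a supermartingale for
  every selection rule: the resampled clause is either put in front of the heap or does not touch it.
  Averaging over the initial assignment leaves \<open>2^(-k)\<close> per clause in a heap, and the sum of
  the weights of the heaps below a set of \<open>m\<close> variables is at most \<open>(1 + \<epsilon>)^m\<close> by splitting off
  one variable at a time, because \<open>L * 2^(-k) * (1 + \<epsilon>)^k \<le> \<epsilon>\<close>.

  With \<open>R\<close> the event \<open>X(i_1) = y_1, \<dots>, X(i_j) = y_j\<close> this gives the upper bound
  \<open>2^(-j) * (1 + \<epsilon>)^j \<le> 2^(-j) + \<epsilon>\<close>. The lower bound comes from the first resampled clause \<open>B\<close> that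
  meets the event's variables while the event holds: \<open>B\<close> and the event are then simultaneously
  true at their variables, and if they share \<open>s\<close> variables this costs \<open>2^(s-j-k)\<close>,
  where \<open>2^(s-j) \<le> s / j\<close>. Events are encoded as the clauses whose violation they are.\<close>

section \<open>Tables and heaps\<close>

text \<open>A table records, for each variable, a prefix of the sequence of bits that the variable
  successively takes.\<close>

type_synonym bit_table = "nat \<Rightarrow> bool list"

text \<open>The left operand is earlier in time: a heap is written with its first resampling
  leftmost and its root rightmost.\<close>

definition glue :: "bit_table \<Rightarrow> bit_table \<Rightarrow> bit_table"  (infixr "\<odot>" 65) where
  "(h \<odot> g) i = h i @ g i"

definition empty_table :: bit_table where
  "empty_table i = []"

definition proper :: "clause \<Rightarrow> bool" where
  "proper C \<longleftrightarrow> (\<forall>i. \<not> ((i, True) \<in> C \<and> (i, False) \<in> C))"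

text \<open>The entries that make a proper clause violated.\<close>

definition falsifier :: "clause \<Rightarrow> bit_table" where
  "falsifier C i = (if i \<in> clause_vars C then [(i, False) \<in> C] else [])"

text \<open>The support of a heap is read off its table: a variable occurs in a clause of the heap
  exactly if its list is nonempty.\<close>

definition touches :: "clause \<Rightarrow> nat set \<Rightarrow> bit_table \<Rightarrow> bool" where
  "touches C M h \<longleftrightarrow> (\<exists>i\<in>clause_vars C. i \<in> M \<or> h i \<noteq> [])"

text \<open>The heaps of at most \<open>m\<close> clauses that lie below a root with variables \<open>M\<close>, built from the
  root downwards. Only the table of a heap is kept, so different heaps may be identified.\<close>

fun heaps :: "clause set \<Rightarrow> nat set \<Rightarrow> nat \<Rightarrow> bit_table set" where
  "heaps \<Psi> M 0 = {empty_table}"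
| "heaps \<Psi> M (Suc m) =
     heaps \<Psi> M m \<union> {falsifier C \<odot> h | C h. C \<in> \<Psi> \<and> h \<in> heaps \<Psi> M m \<and> touches C M h}"

lemma glue_assoc: "(f \<odot> g) \<odot> h = f \<odot> (g \<odot> h)"
  by (rule ext) (simp add: glue_def)

lemma glue_empty [simp]: "empty_table \<odot> h = h" "h \<odot> empty_table = h"
  by (rule ext; simp add: glue_def empty_table_def)+

lemma glue_left_cancel: "f \<odot> g = f \<odot> h \<longleftrightarrow> g = h"
  by (auto simp: glue_def fun_eq_iff)

lemma glue_right_cancel: "g \<odot> f = h \<odot> f \<longleftrightarrow> g = h"
  by (auto simp: glue_def fun_eq_iff)

text \<open>Pieces on disjoint variables commute, which is the defining relation of heaps.\<close>

lemma glue_commute_falsifier: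
  "(\<And>i. i \<in> clause_vars C \<Longrightarrow> h i = []) \<Longrightarrow> falsifier C \<odot> (h \<odot> g) = h \<odot> (falsifier C \<odot> g)"
  by (rule ext) (auto simp: glue_def falsifier_def)

lemma violated_imp_proper: "\<not> satisfies x C \<Longrightarrow> proper C"
  unfolding satisfies_def proper_def by blast

lemma violates_iff:
  assumes "proper C"
  shows "\<not> satisfies x C \<longleftrightarrow> (\<forall>i\<in>clause_vars C. x i = ((i, False) \<in> C))"
proof
  assume unsat: "\<not> satisfies x C"
  show "\<forall>i\<in>clause_vars C. x i = ((i, False) \<in> C)"
  proof
    fix i assume "i \<in> clause_vars C"
    then obtain b where b: "(i, b) \<in> C" by (auto simp: clause_vars_def)
    have "x i \<noteq> c" if "(i, c) \<in> C" for c
      using unsat that by (auto simp: satisfies_def)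
    with b show "x i = ((i, False) \<in> C)" by (cases b) auto
  qed
next
  assume eq: "\<forall>i\<in>clause_vars C. x i = ((i, False) \<in> C)"
  have "x i \<noteq> b" if "(i, b) \<in> C" for i b
  proof -
    have "i \<in> clause_vars C" using that by (force simp: clause_vars_def)
    with eq have "x i = ((i, False) \<in> C)" by blast
    with that assms show ?thesis by (cases b) (auto simp: proper_def)
  qed
  then show "\<not> satisfies x C" by (auto simp: satisfies_def)
qed

lemma card_clause_vars:
  assumes "proper C"
  shows "card (clause_vars C) = card C"
proof -
  have "inj_on fst C"
  proof (rule inj_onI)
    fix p q assume "p \<in> C" "q \<in> C" "fst p = fst q"
    then show "p = q"
      using assms by (cases p; cases q; cases "snd p"; cases "snd q") (auto simp: proper_def)
  qed
  then show ?thesis by (simp add: clause_vars_def card_image)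
qed

lemma finite_heaps: "finite \<Psi> \<Longrightarrow> finite (heaps \<Psi> M m)"
proof (induction m)
  case (Suc m)
  have "{falsifier C \<odot> h | C h. C \<in> \<Psi> \<and> h \<in> heaps \<Psi> M m \<and> touches C M h}
      \<subseteq> (\<lambda>(C, h). falsifier C \<odot> h) ` (\<Psi> \<times> heaps \<Psi> M m)"
    by auto
  moreover have "finite (\<Psi> \<times> heaps \<Psi> M m)" using Suc by simp
  ultimately have "finite {falsifier C \<odot> h | C h. C \<in> \<Psi> \<and> h \<in> heaps \<Psi> M m \<and> touches C M h}"
    using finite_surj by blast
  with Suc show ?case by simp
qed auto

lemma heaps_mono: "m \<le> m' \<Longrightarrow> heaps \<Psi> M m \<subseteq> heaps \<Psi> M m'"
  by (rule lift_Suc_mono_le[of "heaps \<Psi> M"]) auto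

lemma empty_in_heaps: "empty_table \<in> heaps \<Psi> M m"
  using heaps_mono[of 0 m \<Psi> M] by auto

lemma heaps_empty: "heaps \<Psi> {} m = {empty_table}"
  by (induction m) (auto simp: touches_def empty_table_def)

text \<open>The part of a heap below the last clause \<open>C\<close> that contains \<open>i\<close> can be pushed in front of
  the remaining part, which no longer involves \<open>i\<close>.\<close>

lemma heaps_insert_decomp:
  assumes "h \<in> heaps \<Psi> (insert i M) m"
  shows "\<exists>q r. h = q \<odot> r \<and> r \<in> heaps \<Psi> M m \<and>
    (q = empty_table \<or>
     (\<exists>C q' m'. C \<in> \<Psi> \<and> i \<in> clause_vars C \<and> m' < m \<and> q' \<in> heaps \<Psi> (clause_vars C) m' \<and> q = q' \<odot> falsifier C))"
  using assms
proof (induction m arbitrary: h)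
  case 0
  then show ?case by (auto intro: exI[of _ empty_table])
next
  case (Suc m)
  show ?case
  proof (cases "h \<in> heaps \<Psi> (insert i M) m")
    case True
    from Suc.IH[OF this] obtain q r where "h = q \<odot> r" "r \<in> heaps \<Psi> M m"
      "q = empty_table \<or> (\<exists>C q' m'. C \<in> \<Psi> \<and> i \<in> clause_vars C \<and> m' < m \<and>
          q' \<in> heaps \<Psi> (clause_vars C) m' \<and> q = q' \<odot> falsifier C)"
      by blast
    then show ?thesis
      by (intro exI[of _ q] exI[of _ r]) (auto intro: less_SucI)
  next
    case False
    then obtain D g where D: "D \<in> \<Psi>" "g \<in> heaps \<Psi> (insert i M) m" "touches D (insert i M) g"
      and h: "h = falsifier D \<odot> g"
      using Suc.prems by auto
    from Suc.IH[OF D(2)] obtain q r where g: "g = q \<odot> r" and r: "r \<in> heaps \<Psi> M m"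
      and q: "q = empty_table \<or> (\<exists>C q' m'. C \<in> \<Psi> \<and> i \<in> clause_vars C \<and> m' < m \<and>
          q' \<in> heaps \<Psi> (clause_vars C) m' \<and> q = q' \<odot> falsifier C)"
      by blast
    have r': "r \<in> heaps \<Psi> M (Suc m)" using r by simp
    \<comment> \<open>If \<open>D\<close> avoids \<open>i\<close> and the variables of
      \<open>q\<close>, it commutes past \<open>q\<close>; what it touches must then be
      \<open>M\<close> or \<open>r\<close>, so it joins \<open>r\<close>.\<close>
    have push_r: "?thesis" if "\<forall>j\<in>clause_vars D. q j = []" "i \<notin> clause_vars D"
    proof -
      have "touches D M r"
        using D(3) that unfolding touches_def g by (auto simp: glue_def)
      then have "falsifier D \<odot> r \<in> heaps \<Psi> M (Suc m)" using D(1) r by auto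
      moreover have "h = q \<odot> (falsifier D \<odot> r)"
        unfolding h g by (rule glue_commute_falsifier) (use that in auto)
      ultimately show ?thesis using q
        by (intro exI[of _ q] exI[of _ "falsifier D \<odot> r"]) (auto intro: less_SucI)
    qed
    from q show ?thesis
    proof
      assume q0: "q = empty_table"
      show ?thesis
      proof (cases "i \<in> clause_vars D")
        case True
        have "h = (empty_table \<odot> falsifier D) \<odot> r" using h g q0 by simp
        moreover have "empty_table \<in> heaps \<Psi> (clause_vars D) 0" by simp
        ultimately show ?thesis using True D(1) r'
          by (intro exI[of _ "empty_table \<odot> falsifier D"] exI[of _ r]) blast
      next
        case False
        then show ?thesis using push_r q0 by (auto simp: empty_table_def)
      qed
    next
      assume "\<exists>C q' m'. C \<in> \<Psi> \<and> i \<in> clause_vars C \<and> m' < m \<and>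
          q' \<in> heaps \<Psi> (clause_vars C) m' \<and> q = q' \<odot> falsifier C"
      then obtain C q' m' where C: "C \<in> \<Psi>" "i \<in> clause_vars C" "m' < m"
        "q' \<in> heaps \<Psi> (clause_vars C) m'" "q = q' \<odot> falsifier C" by blast
      \<comment> \<open>Either \<open>D\<close> shares a variable with \<open>q\<close> and becomes
        its new front, or it is passed on to \<open>r\<close>.\<close>
      show ?thesis
      proof (cases "\<exists>j\<in>clause_vars D. q j \<noteq> []")
        case True
        then have "touches D (clause_vars C) q'"
          unfolding C(5) touches_def by (auto simp: glue_def falsifier_def split: if_splits)
        then have "falsifier D \<odot> q' \<in> heaps \<Psi> (clause_vars C) (Suc m')"
          using C(4) D(1) by auto
        moreover have "h = ((falsifier D \<odot> q') \<odot> falsifier C) \<odot> r"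
          unfolding h g C(5) by (simp add: glue_assoc)
        moreover have "Suc m' < Suc m" using C(3) by simp
        ultimately show ?thesis using C(1,2) r'
          by (intro exI[of _ "(falsifier D \<odot> q') \<odot> falsifier C"] exI[of _ r]) blast
      next
        case False
        then have "i \<notin> clause_vars D"
          using C(2) unfolding C(5) by (auto simp: glue_def falsifier_def)
        with False show ?thesis using push_r by blast
      qed
    qed
  qed
qed

text \<open>The depth of the part \<open>q\<close> is relaxed to \<open>m\<close>, so that an
  induction on the depth applies to it.\<close>

lemma heaps_insert_subset:
  "heaps \<Psi> (insert i M) (Suc m) \<subseteq>
     (\<lambda>(q, r). q \<odot> r) `
       (insert empty_table (\<Union>C\<in>{C \<in> \<Psi>. i \<in> clause_vars C}. (\<lambda>q. q \<odot> falsifier C) ` heaps \<Psi> (clause_vars C) m)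
        \<times> heaps \<Psi> M (Suc m))"
proof
  fix h assume "h \<in> heaps \<Psi> (insert i M) (Suc m)"
  from heaps_insert_decomp[OF this] obtain q r where
    h: "h = q \<odot> r" "r \<in> heaps \<Psi> M (Suc m)" and
    q: "q = empty_table \<or> (\<exists>C q' m'. C \<in> \<Psi> \<and> i \<in> clause_vars C \<and> m' < Suc m \<and>
      q' \<in> heaps \<Psi> (clause_vars C) m' \<and> q = q' \<odot> falsifier C)"
    by blast
  have "q \<in> insert empty_table (\<Union>C\<in>{C \<in> \<Psi>. i \<in> clause_vars C}. (\<lambda>q. q \<odot> falsifier C) ` heaps \<Psi> (clause_vars C) m)"
    using q
  proof
    assume "\<exists>C q' m'. C \<in> \<Psi> \<and> i \<in> clause_vars C \<and> m' < Suc m \<and>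
      q' \<in> heaps \<Psi> (clause_vars C) m' \<and> q = q' \<odot> falsifier C"
    then obtain C q' m' where "C \<in> \<Psi>" "i \<in> clause_vars C" "m' < Suc m"
      "q' \<in> heaps \<Psi> (clause_vars C) m'" "q = q' \<odot> falsifier C" by blast
    moreover from this have "q' \<in> heaps \<Psi> (clause_vars C) m"
      using heaps_mono[of m' m] by auto
    ultimately show ?thesis by blast
  qed auto
  with h show "h \<in> (\<lambda>(q, r). q \<odot> r) `
       (insert empty_table (\<Union>C\<in>{C \<in> \<Psi>. i \<in> clause_vars C}. (\<lambda>q. q \<odot> falsifier C) ` heaps \<Psi> (clause_vars C) m)
        \<times> heaps \<Psi> M (Suc m))"
    by (intro image_eqI[of _ _ "(q, r)"]) auto
qed

section \<open>Weights\<close>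

definition table_prob :: "nat \<Rightarrow> bit_table \<Rightarrow> real" where
  "table_prob n h = (\<Prod>i\<in>{1..n}. 1 / 2 ^ length (h i))"

fun bits_weight :: "bool \<Rightarrow> bool list \<Rightarrow> real" where
  "bits_weight b [] = 1"
| "bits_weight b (c # cs) = (if b = c then 1 / 2 ^ length cs else 0)"

text \<open>The conditional probability that a table of independent uniform bits extends \<open>h\<close>,
  given that its first entries are \<open>x\<close>.\<close>

definition table_weight :: "nat \<Rightarrow> assignment \<Rightarrow> bit_table \<Rightarrow> real" where
  "table_weight n x h = (\<Prod>i\<in>{1..n}. bits_weight (x i) (h i))"

lemma table_prob_nonneg [simp]: "0 \<le> table_prob n h"
  by (simp add: table_prob_def prod_nonneg)

lemma bits_weight_nonneg [simp]: "0 \<le> bits_weight b cs"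
  by (cases cs) auto

lemma table_weight_nonneg [simp]: "0 \<le> table_weight n x h"
  by (simp add: table_weight_def prod_nonneg)

lemma table_prob_glue: "table_prob n (g \<odot> h) = table_prob n g * table_prob n h"
  by (simp add: table_prob_def glue_def power_add prod.distrib[symmetric])

lemma table_prob_empty [simp]: "table_prob n empty_table = 1"
  by (simp add: table_prob_def empty_table_def)

lemma table_prob_falsifier:
  assumes "clause_vars C \<subseteq> {1..n}"
  shows "table_prob n (falsifier C) = 1 / 2 ^ card (clause_vars C)"
proof -
  have "table_prob n (falsifier C) = (\<Prod>i\<in>{1..n}. if i \<in> clause_vars C then 1 / 2 else 1)"
    unfolding table_prob_def by (rule prod.cong) (auto simp: falsifier_def)
  also have "\<dots> = (\<Prod>i\<in>clause_vars C. 1 / 2)"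
    using assms by (simp add: prod.If_cases Int_absorb1)
  finally show ?thesis by (simp add: power_divide)
qed

text \<open>The outer induction on \<open>m\<close> bounds the heaps below each clause containing
  \<open>i\<close>; the inner one on \<open>M\<close> splits off \<open>i\<close>. A nonempty front
  factor ends in one of at most \<open>L\<close> such clauses, and each of these costs at most
  \<open>2^(-k) * (1 + \<epsilon>)^k\<close>.\<close>

lemma sum_heaps_le:
  assumes fin: "finite \<Psi>"
    and clauses: "\<And>C. C \<in> \<Psi> \<Longrightarrow> clause_vars C \<subseteq> {1..n} \<and> card (clause_vars C) = k"
    and deg: "\<And>i. i \<in> {1..n} \<Longrightarrow> card {C \<in> \<Psi>. i \<in> clause_vars C} \<le> L"
    and eps: "0 \<le> \<epsilon>" "real L * ((1 + \<epsilon>) ^ k / 2 ^ k) \<le> \<epsilon>"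
    and M: "M \<subseteq> {1..n}"
  shows "(\<Sum>h\<in>heaps \<Psi> M m. table_prob n h) \<le> (1 + \<epsilon>) ^ card M"
  using M
proof (induction m arbitrary: M)
  case 0
  then show ?case using eps by simp
next
  case (Suc m)
  have "finite M" using Suc.prems finite_subset by blast
  then show ?case using Suc.prems
  proof (induction M rule: finite_induct)
    case empty
    then show ?case by (simp only: heaps_empty) simp
  next
    case (insert i M)
    let ?I = "{C \<in> \<Psi>. i \<in> clause_vars C}"
    let ?Q = "\<lambda>C. (\<lambda>q. q \<odot> falsifier C) ` heaps \<Psi> (clause_vars C) m"
    let ?A = "insert empty_table (\<Union>C\<in>?I. ?Q C)"
    have finI: "finite ?I" using fin by simp
    have finA: "finite ?A" using fin finite_heaps by auto
    have Q: "(\<Sum>q\<in>heaps \<Psi> (clause_vars C) m. table_prob n (q \<odot> falsifier C)) \<le> (1 + \<epsilon>) ^ k / 2 ^ k"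
      if "C \<in> ?I" for C
    proof -
      have C: "clause_vars C \<subseteq> {1..n}" "card (clause_vars C) = k" using clauses that by auto
      have "(\<Sum>q\<in>heaps \<Psi> (clause_vars C) m. table_prob n (q \<odot> falsifier C))
          = (\<Sum>q\<in>heaps \<Psi> (clause_vars C) m. table_prob n q) / 2 ^ k"
        using C by (simp add: table_prob_glue table_prob_falsifier sum_divide_distrib)
      also have "\<dots> \<le> (1 + \<epsilon>) ^ k / 2 ^ k"
        using Suc.IH[OF C(1)] C(2) by (simp add: divide_right_mono)
      finally show ?thesis .
    qed
    have UQ: "(\<Union>C\<in>?I. ?Q C) = (\<lambda>(C, q). q \<odot> falsifier C) ` (SIGMA C:?I. heaps \<Psi> (clause_vars C) m)"
      by force
    have "sum (table_prob n) ?A \<le> 1 + sum (table_prob n) (\<Union>C\<in>?I. ?Q C)"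
      using finA by (subst sum.insert_if) auto
    also have "sum (table_prob n) (\<Union>C\<in>?I. ?Q C)
        \<le> (\<Sum>(C, q)\<in>(SIGMA C:?I. heaps \<Psi> (clause_vars C) m). table_prob n (q \<odot> falsifier C))"
      unfolding UQ using finI finite_heaps[OF fin]
      by (intro order_trans[OF sum_image_le]) (auto simp: case_prod_unfold)
    also have "\<dots> = (\<Sum>C\<in>?I. \<Sum>q\<in>heaps \<Psi> (clause_vars C) m. table_prob n (q \<odot> falsifier C))"
      using finI finite_heaps[OF fin] by (intro sum.Sigma[symmetric]) auto
    also have "\<dots> \<le> (\<Sum>C\<in>?I. (1 + \<epsilon>) ^ k / 2 ^ k)"
      using Q by (rule sum_mono)
    also have "\<dots> = real (card ?I) * ((1 + \<epsilon>) ^ k / 2 ^ k)" by simp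
    also have "\<dots> \<le> real L * ((1 + \<epsilon>) ^ k / 2 ^ k)"
      using deg[of i] insert.prems eps by (intro mult_right_mono) auto
    also have "\<dots> \<le> \<epsilon>" by (rule eps)
    finally have A: "sum (table_prob n) ?A \<le> 1 + \<epsilon>" by simp
    have "(\<Sum>h\<in>heaps \<Psi> (insert i M) (Suc m). table_prob n h)
        \<le> (\<Sum>h\<in>(\<lambda>(q, r). q \<odot> r) ` (?A \<times> heaps \<Psi> M (Suc m)). table_prob n h)"
      using finA finite_heaps[OF fin, of M "Suc m"] heaps_insert_subset[of \<Psi> i M m]
      by (intro sum_mono2) (auto simp del: heaps.simps)
    \<comment> \<open>The factorisation need not be unique; as weights are nonnegative, the sum over
      pairs is an upper bound.\<close>
    also have "\<dots> \<le> (\<Sum>(q, r)\<in>?A \<times> heaps \<Psi> M (Suc m). table_prob n (q \<odot> r))"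
      using finA finite_heaps[OF fin, of M "Suc m"]
      by (intro order_trans[OF sum_image_le]) (auto simp: case_prod_unfold simp del: heaps.simps)
    also have "\<dots> = sum (table_prob n) ?A * sum (table_prob n) (heaps \<Psi> M (Suc m))"
      by (simp only: table_prob_glue sum_product sum.cartesian_product)
    also have "\<dots> \<le> (1 + \<epsilon>) * (1 + \<epsilon>) ^ card M"
      using A insert.IH insert.prems eps by (intro mult_mono sum_nonneg) auto
    finally show ?case using insert.hyps by simp
  qed
qed

section \<open>Averages of weights over fresh bits\<close>

lemma nn_integral_uniform_bits_weight:
  assumes "finite V"
  shows "(\<integral>\<^sup>+y. ennreal (\<Prod>i\<in>V. bits_weight (y i) (h i)) \<partial>uniform_bits V)
    = ennreal (\<Prod>i\<in>V. 1 / 2 ^ length (h i))"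
proof -
  \<comment> \<open>For a nonempty list, \<open>bits_weight\<close> leaves out the factor 1/2 of the
    first entry; averaging over the first bit supplies it.\<close>
  have bit: "(\<integral>\<^sup>+b. ennreal (bits_weight b cs) \<partial>bernoulli_pmf (1/2)) = ennreal (1 / 2 ^ length cs)" for cs
  proof (cases cs)
    case (Cons c cs')
    have "ennreal (1 / 2 ^ length cs') * ennreal (1/2) = ennreal (1 / 2 ^ length cs)"
      by (subst ennreal_mult[symmetric]) (auto simp: Cons)
    then show ?thesis by (cases c) (simp_all add: Cons)
  qed (simp flip: ennreal_plus)
  have "(\<integral>\<^sup>+y. ennreal (\<Prod>i\<in>V. bits_weight (y i) (h i)) \<partial>uniform_bits V)
      = (\<integral>\<^sup>+y. (\<Prod>i\<in>V. ennreal (bits_weight (y i) (h i))) \<partial>uniform_bits V)"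
    by (simp add: prod_ennreal)
  also have "\<dots> = (\<Prod>i\<in>V. \<integral>\<^sup>+b. ennreal (bits_weight b (h i)) \<partial>bernoulli_pmf (1/2))"
    unfolding uniform_bits_def
    by (rule nn_integral_prod_Pi_pmf[OF assms, where f = "\<lambda>i b. ennreal (bits_weight b (h i))"])
  also have "\<dots> = ennreal (\<Prod>i\<in>V. 1 / 2 ^ length (h i))"
    by (simp only: bit) (simp add: prod_ennreal)
  finally show ?thesis .
qed

lemma nn_integral_uniform_table_weight:
  "(\<integral>\<^sup>+x. ennreal (table_weight n x h) \<partial>uniform_bits {1..n}) = ennreal (table_prob n h)"
  unfolding table_weight_def table_prob_def by (rule nn_integral_uniform_bits_weight) simp

lemma nn_integral_resample_table_weight:
  assumes "clause_vars C \<subseteq> {1..n}"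
  shows "(\<integral>\<^sup>+x'. ennreal (table_weight n x' h) \<partial>resample C x)
    = ennreal ((\<Prod>i\<in>clause_vars C. 1 / 2 ^ length (h i)) *
               (\<Prod>i\<in>{1..n} - clause_vars C. bits_weight (x i) (h i)))"
proof -
  let ?V = "clause_vars C"
  let ?r = "\<Prod>i\<in>{1..n} - ?V. bits_weight (x i) (h i)"
  have fin: "finite ?V" using assms finite_subset by blast
  have split: "table_weight n (override_on x y ?V) h = (\<Prod>i\<in>?V. bits_weight (y i) (h i)) * ?r" for y
  proof -
    have "table_weight n (override_on x y ?V) h
        = (\<Prod>i\<in>{1..n} - ?V. bits_weight (override_on x y ?V i) (h i)) *
          (\<Prod>i\<in>?V. bits_weight (override_on x y ?V i) (h i))"
      unfolding table_weight_def by (rule prod.subset_diff) (use assms in auto)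
    then show ?thesis by (simp add: mult.commute)
  qed
  have "(\<integral>\<^sup>+x'. ennreal (table_weight n x' h) \<partial>resample C x)
      = (\<integral>\<^sup>+y. ennreal (\<Prod>i\<in>?V. bits_weight (y i) (h i)) * ennreal ?r \<partial>uniform_bits ?V)"
    by (simp add: resample_def split ennreal_mult prod_nonneg)
  also have "\<dots> = ennreal (\<Prod>i\<in>?V. 1 / 2 ^ length (h i)) * ennreal ?r"
    by (simp add: nn_integral_multc nn_integral_uniform_bits_weight[OF fin])
  finally show ?thesis by (simp add: ennreal_mult prod_nonneg)
qed

text \<open>After fresh bits are averaged out, every entry of \<open>h\<close> on the variables of
  \<open>C\<close> counts 1/2. It counts the same behind the entry of \<open>C\<close>, which agrees
  with \<open>x\<close> because \<open>C\<close> is violated.\<close>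

lemma nn_integral_resample_push:
  assumes C: "clause_vars C \<subseteq> {1..n}" and unsat: "\<not> satisfies x C"
  shows "(\<integral>\<^sup>+x'. ennreal (table_weight n x' h) \<partial>resample C x)
    = ennreal (table_weight n x (falsifier C \<odot> h))"
proof -
  have x: "x i = ((i, False) \<in> C)" if "i \<in> clause_vars C" for i
    using violates_iff[OF violated_imp_proper[OF unsat]] unsat that by blast
  have "table_weight n x (falsifier C \<odot> h)
      = (\<Prod>i\<in>{1..n} - clause_vars C. bits_weight (x i) ((falsifier C \<odot> h) i)) *
        (\<Prod>i\<in>clause_vars C. bits_weight (x i) ((falsifier C \<odot> h) i))"
    unfolding table_weight_def by (rule prod.subset_diff) (use C in auto)
  also have "\<dots> = (\<Prod>i\<in>{1..n} - clause_vars C. bits_weight (x i) (h i)) *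
        (\<Prod>i\<in>clause_vars C. 1 / 2 ^ length (h i))"
    by (intro arg_cong2[where f = "(*)"] prod.cong) (auto simp: x glue_def falsifier_def)
  finally show ?thesis
    using nn_integral_resample_table_weight[OF C] by (simp add: mult.commute)
qed

lemma nn_integral_resample_skip:
  assumes C: "clause_vars C \<subseteq> {1..n}" and h: "\<And>i. i \<in> clause_vars C \<Longrightarrow> h i = []"
  shows "(\<integral>\<^sup>+x'. ennreal (table_weight n x' h) \<partial>resample C x) = ennreal (table_weight n x h)"
proof -
  have "table_weight n x h
      = (\<Prod>i\<in>{1..n} - clause_vars C. bits_weight (x i) (h i)) *
        (\<Prod>i\<in>clause_vars C. bits_weight (x i) (h i))"
    unfolding table_weight_def by (rule prod.subset_diff) (use C in auto)
  then show ?thesis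
    using nn_integral_resample_table_weight[OF C, where h = h and x = x] by (simp add: h)
qed

section \<open>Heap sums as supermartingales\<close>

lemma table_weight_falsifier:
  assumes "proper C" "clause_vars C \<subseteq> {1..n}"
  shows "table_weight n x (falsifier C) = of_bool (\<not> satisfies x C)"
proof -
  have "table_weight n x (falsifier C)
      = (\<Prod>i\<in>{1..n}. of_bool (i \<in> clause_vars C \<longrightarrow> x i = ((i, False) \<in> C)))"
    unfolding table_weight_def by (rule prod.cong) (auto simp: falsifier_def)
  also have "\<dots> = of_bool (\<forall>i\<in>{1..n}. i \<in> clause_vars C \<longrightarrow> x i = ((i, False) \<in> C))"
  proof (cases "\<forall>i\<in>{1..n}. i \<in> clause_vars C \<longrightarrow> x i = ((i, False) \<in> C)")
    case False
    then show ?thesis by (auto intro!: prod_zero)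
  qed auto
  also have "(\<forall>i\<in>{1..n}. i \<in> clause_vars C \<longrightarrow> x i = ((i, False) \<in> C)) \<longleftrightarrow> \<not> satisfies x C"
    using assms by (auto simp: violates_iff)
  finally show ?thesis .
qed

text \<open>The expected number of heap tables, completed by the root \<open>R\<close>, that a
  random table with first row \<open>x\<close> extends. \<open>M\<close> is kept apart from the
  variables of \<open>R\<close>, since in the lower bound the root has more variables than the heap
  may grow from.\<close>

definition root_sum :: "nat \<Rightarrow> clause set \<Rightarrow> nat set \<Rightarrow> clause \<Rightarrow> nat \<Rightarrow> assignment \<Rightarrow> real" where
  "root_sum n \<Psi> M R m x = (\<Sum>h\<in>heaps \<Psi> M m. table_weight n x (h \<odot> falsifier R))"

lemma root_sum_nonneg [simp]: "0 \<le> root_sum n \<Psi> M R m x"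
  by (simp add: root_sum_def sum_nonneg)

lemma root_sum_ge_indicator:
  assumes "finite \<Psi>" "\<not> satisfies x R" "clause_vars R \<subseteq> {1..n}"
  shows "1 \<le> root_sum n \<Psi> M R m x"
proof -
  have "1 = table_weight n x (empty_table \<odot> falsifier R)"
    using assms by (simp add: table_weight_falsifier violated_imp_proper)
  also have "\<dots> \<le> root_sum n \<Psi> M R m x"
    unfolding root_sum_def
    by (rule member_le_sum) (auto simp: finite_heaps assms(1) empty_in_heaps)
  finally show ?thesis .
qed

lemma nn_integral_uniform_root_sum:
  assumes "clause_vars R \<subseteq> {1..n}"
  shows "(\<integral>\<^sup>+x. ennreal (root_sum n \<Psi> M R m x) \<partial>uniform_bits {1..n})
    = ennreal ((\<Sum>h\<in>heaps \<Psi> M m. table_prob n h) / 2 ^ card (clause_vars R))"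
proof -
  have "(\<integral>\<^sup>+x. ennreal (root_sum n \<Psi> M R m x) \<partial>uniform_bits {1..n})
      = (\<Sum>h\<in>heaps \<Psi> M m. \<integral>\<^sup>+x. ennreal (table_weight n x (h \<odot> falsifier R)) \<partial>uniform_bits {1..n})"
    unfolding root_sum_def by (subst nn_integral_sum[symmetric]) (auto simp: sum_ennreal)
  also have "\<dots> = ennreal (\<Sum>h\<in>heaps \<Psi> M m. table_prob n (h \<odot> falsifier R))"
    by (simp only: nn_integral_uniform_table_weight) (simp add: sum_ennreal)
  finally show ?thesis
    by (simp add: table_prob_glue table_prob_falsifier[OF assms] sum_divide_distrib)
qed

text \<open>Prepending the resampled clause \<open>C\<close> to a heap that it touches is injective, and its values
  are touched by \<open>C\<close>; so they are distinct from the heaps that \<open>C\<close> leaves alone.\<close>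

lemma root_sum_step:
  assumes fin: "finite \<Psi>" and C: "C \<in> \<Psi>" "clause_vars C \<subseteq> {1..n}" "clause_vars C \<noteq> {}"
    and unsat: "\<not> satisfies x C" and M: "clause_vars C \<inter> clause_vars R \<subseteq> M"
  shows "(\<integral>\<^sup>+x'. ennreal (root_sum n \<Psi> M R m x') \<partial>resample C x)
      + ennreal (if clause_vars C \<inter> M = {} then 0 else table_weight n x (falsifier R))
    \<le> ennreal (root_sum n \<Psi> M R (Suc m) x)"
proof -
  let ?w = "\<lambda>h. table_weight n x (h \<odot> falsifier R)"
  let ?H = "heaps \<Psi> M m"
  let ?T = "{h \<in> ?H. touches C M h}"
  let ?P = "(\<lambda>h. falsifier C \<odot> h) ` ?T"
  \<comment> \<open>If \<open>C\<close> meets \<open>M\<close>, the empty heap is neither of the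
    pushed form nor left alone by \<open>C\<close>; its weight is the surplus that drives
    termination.\<close>
  let ?Z = "if clause_vars C \<inter> M = {} then {} else {empty_table}"
  have finH: "finite ?H" using fin by (rule finite_heaps)
  have each: "(\<integral>\<^sup>+x'. ennreal (table_weight n x' (h \<odot> falsifier R)) \<partial>resample C x)
      = ennreal (if touches C M h then ?w (falsifier C \<odot> h) else ?w h)" for h
  proof (cases "touches C M h")
    case True
    then show ?thesis using nn_integral_resample_push[OF C(2) unsat] by (simp add: glue_assoc)
  next
    case False
    then have "(h \<odot> falsifier R) i = []" if "i \<in> clause_vars C" for i
      using that M by (auto simp: touches_def glue_def falsifier_def)
    then show ?thesis using nn_integral_resample_skip[OF C(2)] False by simp
  qed
  have "(\<integral>\<^sup>+x'. ennreal (root_sum n \<Psi> M R m x') \<partial>resample C x)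
      = (\<Sum>h\<in>?H. \<integral>\<^sup>+x'. ennreal (table_weight n x' (h \<odot> falsifier R)) \<partial>resample C x)"
    unfolding root_sum_def by (subst nn_integral_sum[symmetric]) (auto simp: sum_ennreal)
  also have "\<dots> = ennreal (\<Sum>h\<in>?H. if touches C M h then ?w (falsifier C \<odot> h) else ?w h)"
    unfolding each by (simp add: sum_ennreal)
  also have "(\<Sum>h\<in>?H. if touches C M h then ?w (falsifier C \<odot> h) else ?w h)
      = (\<Sum>h\<in>?T. ?w (falsifier C \<odot> h)) + sum ?w (?H - ?T)"
    by (simp add: sum.If_cases finH Int_def set_diff_eq conj_commute) (meson)
  also have "(\<Sum>h\<in>?T. ?w (falsifier C \<odot> h)) = sum ?w ?P"
    by (rule sum.reindex_cong[symmetric, where l = "\<lambda>h. falsifier C \<odot> h"])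
      (auto simp: inj_on_def glue_left_cancel)
  finally have int: "(\<integral>\<^sup>+x'. ennreal (root_sum n \<Psi> M R m x') \<partial>resample C x)
      = ennreal (sum ?w ?P + sum ?w (?H - ?T))" .
  have pushed: "\<exists>i\<in>clause_vars C. (falsifier C \<odot> h) i \<noteq> []" for h
    using C(3) by (auto simp: glue_def falsifier_def)
  have disj: "?P \<inter> (?H - ?T) = {}"
    using pushed by (auto simp: touches_def)
  have disjZ: "(?P \<union> (?H - ?T)) \<inter> ?Z = {}"
  proof -
    have "empty_table \<notin> ?P"
    proof
      assume "empty_table \<in> ?P"
      then obtain h where "empty_table = falsifier C \<odot> h" by blast
      then show False using pushed[of h] by (metis empty_table_def)
    qed
    moreover have "empty_table \<in> ?T" if "clause_vars C \<inter> M \<noteq> {}"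
      using that by (auto simp: touches_def empty_in_heaps)
    ultimately show ?thesis by auto
  qed
  have "sum ?w ?P + sum ?w (?H - ?T) + (if clause_vars C \<inter> M = {} then 0 else table_weight n x (falsifier R))
      = sum ?w (?P \<union> (?H - ?T) \<union> ?Z)"
    using finH disj disjZ by (subst sum.union_disjoint; (simp add: sum.union_disjoint)?)
  also have "\<dots> \<le> root_sum n \<Psi> M R (Suc m) x"
    unfolding root_sum_def
    by (rule sum_mono2) (use fin C(1) in \<open>auto simp: finite_heaps empty_in_heaps simp del: heaps.simps\<close>,
        auto)
  finally show ?thesis
    unfolding int by (subst ennreal_plus[symmetric]) (auto intro!: sum_nonneg add_nonneg_nonneg)
qed

lemma root_sum_supermartingale:
  assumes "finite \<Psi>" "C \<in> \<Psi>" "clause_vars C \<subseteq> {1..n}" "clause_vars C \<noteq> {}"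
    and "\<not> satisfies x C" "clause_vars C \<inter> clause_vars R \<subseteq> M"
  shows "(\<integral>\<^sup>+x'. ennreal (root_sum n \<Psi> M R m x') \<partial>resample C x) \<le> ennreal (root_sum n \<Psi> M R (Suc m) x)"
  using root_sum_step[OF assms] by (rule order_trans[rotated]) simp

section \<open>The Moser-Tardos process\<close>

text \<open>\<open>F\<close> is a supermartingale that dominates the event \<open>S\<close> on termination, and \<open>G\<close> decreases
  by one per step in expectation, so that the run lasts at most \<open>G\<close> steps on average. The index \<open>t\<close>
  only serves to truncate both.\<close>

lemma mt_loop_bound:
  assumes rule: "valid_rule \<Phi> sel"
    and F_end: "\<And>t x. violated \<Phi> x = {} \<Longrightarrow> indicator S (Some x) \<le> F t x"
    and F_step: "\<And>t x C. C \<in> violated \<Phi> x \<Longrightarrow> (\<integral>\<^sup>+x'. F t x' \<partial>resample C x) \<le> F (Suc t) x"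
    and G_step: "\<And>t x C. C \<in> violated \<Phi> x \<Longrightarrow> (\<integral>\<^sup>+x'. G t x' \<partial>resample C x) + 1 \<le> G (Suc t) x"
  shows "of_nat t * emeasure (measure_pmf (mt_loop \<Phi> sel h x)) S \<le> of_nat t * F t x + G t x"
proof (induction t arbitrary: h x)
  case (Suc t)
  let ?v = "\<lambda>h x. emeasure (measure_pmf (mt_loop \<Phi> sel h x)) S"
  show ?case
  proof (cases "violated \<Phi> x = {}")
    case True
    then have "?v h x = indicator S (Some x)"
      by (subst mt_loop.simps) simp
    then have "?v h x \<le> F (Suc t) x" using F_end[OF True] by simp
    then show ?thesis by (intro add_increasing2 mult_left_mono) auto
  next
    case False
    let ?B = "of_nat (Suc t) * F (Suc t) x + G (Suc t) x"
    have branch: "of_nat (Suc t) * (\<integral>\<^sup>+x'. ?v ((x, C) # h) x' \<partial>resample C x) \<le> ?B"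
      if "C \<in> violated \<Phi> x" for C
    proof -
      let ?u = "\<lambda>x'. ?v ((x, C) # h) x'"
      \<comment> \<open>Of the \<open>t + 1\<close> copies, \<open>t\<close> go to the induction
        hypothesis; the last is bounded by 1 and paid for by the decrease of
        \<open>G\<close>.\<close>
      have "of_nat (Suc t) * (\<integral>\<^sup>+x'. ?u x' \<partial>resample C x)
          = (\<integral>\<^sup>+x'. of_nat t * ?u x' \<partial>resample C x) + (\<integral>\<^sup>+x'. ?u x' \<partial>resample C x)"
        by (simp add: nn_integral_cmult distrib_right add.commute)
      also have "\<dots> \<le> (\<integral>\<^sup>+x'. of_nat t * F t x' + G t x' \<partial>resample C x) + (\<integral>\<^sup>+x'. 1 \<partial>resample C x)"
        by (intro add_mono nn_integral_mono Suc.IH measure_pmf.emeasure_le_1)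
      also have "\<dots> = of_nat t * (\<integral>\<^sup>+x'. F t x' \<partial>resample C x) + ((\<integral>\<^sup>+x'. G t x' \<partial>resample C x) + 1)"
        by (simp add: nn_integral_add nn_integral_cmult add.assoc)
      also have "\<dots> \<le> of_nat t * F (Suc t) x + G (Suc t) x"
        by (intro add_mono mult_left_mono F_step G_step that) auto
      also have "\<dots> \<le> ?B"
        by (intro add_right_mono mult_right_mono) auto
      finally show ?thesis .
    qed
    have "mt_loop \<Phi> sel h x
        = bind_pmf (sel h x) (\<lambda>C. bind_pmf (resample C x) (\<lambda>x'. mt_loop \<Phi> sel ((x, C) # h) x'))"
      using False by (subst mt_loop.simps) simp
    then have "of_nat (Suc t) * ?v h x
        = (\<integral>\<^sup>+C. of_nat (Suc t) * (\<integral>\<^sup>+x'. ?v ((x, C) # h) x' \<partial>resample C x) \<partial>sel h x)"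
      by (simp add: nn_integral_cmult del: of_nat_Suc)
    also have "\<dots> \<le> (\<integral>\<^sup>+C. ?B \<partial>sel h x)"
      using rule False branch
      by (intro nn_integral_mono_AE) (auto simp: AE_measure_pmf_iff valid_rule_def simp del: of_nat_Suc)
    finally show ?thesis by simp
  qed
qed simp

text \<open>After division by \<open>t\<close> the running time contributes \<open>g / t\<close>,
  which vanishes as \<open>t\<close> grows.\<close>

lemma mt_output_bound:
  assumes rule: "valid_rule \<Phi> sel"
    and F_end: "\<And>t x. violated \<Phi> x = {} \<Longrightarrow> indicator S (Some x) \<le> F t x"
    and F_step: "\<And>t x C. C \<in> violated \<Phi> x \<Longrightarrow> (\<integral>\<^sup>+x'. F t x' \<partial>resample C x) \<le> F (Suc t) x"
    and G_step: "\<And>t x C. C \<in> violated \<Phi> x \<Longrightarrow> (\<integral>\<^sup>+x'. G t x' \<partial>resample C x) + 1 \<le> G (Suc t) x"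
    and F_avg: "\<And>t. (\<integral>\<^sup>+x. F t x \<partial>uniform_bits {1..n}) \<le> ennreal f"
    and G_avg: "\<And>t. (\<integral>\<^sup>+x. G t x \<partial>uniform_bits {1..n}) \<le> ennreal g"
    and nonneg: "0 \<le> f" "0 \<le> g"
  shows "measure (measure_pmf (mt_output n \<Phi> sel)) S \<le> f"
proof -
  let ?P = "measure (measure_pmf (mt_output n \<Phi> sel)) S"
  have bound: "real t * ?P \<le> real t * f + g" for t
  proof -
    have "of_nat t * emeasure (measure_pmf (mt_output n \<Phi> sel)) S
        = (\<integral>\<^sup>+x. of_nat t * emeasure (measure_pmf (mt_loop \<Phi> sel [] x)) S \<partial>uniform_bits {1..n})"
      by (simp add: mt_output_def nn_integral_cmult)
    also have "\<dots> \<le> (\<integral>\<^sup>+x. of_nat t * F t x + G t x \<partial>uniform_bits {1..n})"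
      by (intro nn_integral_mono mt_loop_bound) (use assms in auto)
    also have "\<dots> \<le> of_nat t * ennreal f + ennreal g"
      by (simp add: nn_integral_add nn_integral_cmult)
        (intro add_mono mult_left_mono F_avg[simplified] G_avg[simplified]; simp)
    finally have "ennreal (real t * ?P) \<le> ennreal (real t * f + g)"
      using nonneg by (simp add: measure_pmf.emeasure_eq_measure ennreal_mult ennreal_of_nat_eq_real_of_nat)
    then show ?thesis using nonneg by (subst (asm) ennreal_le_iff) auto
  qed
  show ?thesis
  proof (rule ccontr)
    assume "\<not> ?P \<le> f"
    then obtain t where "g < real t * (?P - f)"
      using reals_Archimedean3[of "?P - f"] by auto
    with bound[of t] show False by (simp add: algebra_simps)
  qed
qed

text \<open>The right-hand side is the chord of a convex function between \<open>x = 0\<close> and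
  \<open>x = 1\<close>. It turns \<open>2^(-j) * (1 + \<epsilon>)^j\<close> into
  \<open>2^(-j) + \<epsilon>\<close>.\<close>

lemma power_one_plus_le:
  fixes x :: real
  assumes "0 \<le> x" "x \<le> 1"
  shows "(1 + x) ^ j \<le> 1 + (2 ^ j - 1) * x"
proof (induction j)
  case (Suc j)
  have "(1 + x) ^ Suc j \<le> (1 + x) * (1 + (2 ^ j - 1) * x)"
    using Suc assms by simp
  also have "\<dots> = 1 + 2 ^ j * x + (2 ^ j - 1) * (x * x)"
    by (simp add: algebra_simps)
  also have "\<dots> \<le> 1 + 2 ^ j * x + (2 ^ j - 1) * x"
    using assms by (intro add_left_mono mult_left_mono) (auto intro: mult_left_le)
  finally show ?case by (simp add: algebra_simps)
qed simp

text \<open>The quotient \<open>2^s / s\<close> does not decrease for \<open>s\<close> at least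
  1.\<close>

lemma mult_power2_le:
  fixes s j :: nat
  assumes "1 \<le> s" "s \<le> j"
  shows "j * 2 ^ s \<le> s * 2 ^ j"
  using assms(2)
proof (induction j rule: dec_induct)
  case (step j)
  have "(2::nat) ^ s \<le> 2 ^ j" using step by simp
  also have "\<dots> \<le> s * 2 ^ j" using assms by simp
  finally show ?case using step.IH by simp
qed simp

section \<open>The constant \<epsilon> and termination for sparse instances\<close>

locale sparse_ksat =
  fixes n k L :: nat and \<Phi> :: "clause set"
  assumes instance_ksat: "ksat_instance n k \<Phi>"
    and occurrences: "occurrences_at_most n L \<Phi>"
    and density: "real L \<le> 2 ^ k / (exp 1 * real k)"
    and k_pos: "1 \<le> k"
begin

definition \<epsilon> :: real where
  "\<epsilon> = exp 1 * real L / 2 ^ k"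

text \<open>Clauses containing both literals of some variable are never violated, hence irrelevant.\<close>

definition \<Psi> :: "clause set" where
  "\<Psi> = {C \<in> \<Phi>. proper C}"

text \<open>Counts the witness heaps of all possible resamplings, with each clause as a root; a
  resampling uses up at least one of them in expectation.\<close>

definition runtime_potential :: "nat \<Rightarrow> assignment \<Rightarrow> real" where
  "runtime_potential t x = (\<Sum>B\<in>\<Psi>. root_sum n \<Psi> (clause_vars B) B t x)"

lemma \<epsilon>_nonneg: "0 \<le> \<epsilon>"
  by (simp add: \<epsilon>_def)

lemma \<epsilon>_le: "\<epsilon> \<le> 1 / real k"
  using density k_pos by (simp add: \<epsilon>_def field_simps)

lemma \<epsilon>_le_1: "\<epsilon> \<le> 1"
  using \<epsilon>_le k_pos by (smt (verit) divide_le_eq_1_pos of_nat_1 of_nat_mono)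

text \<open>The density hypothesis amounts to \<open>k * \<epsilon> \<le> 1\<close>, and
  \<open>1 + \<epsilon>\<close> is at most \<open>exp \<epsilon>\<close>.\<close>

lemma power_\<epsilon>_le: "(1 + \<epsilon>) ^ k \<le> exp 1"
proof -
  have "(1 + \<epsilon>) ^ k \<le> exp \<epsilon> ^ k"
    using \<epsilon>_nonneg by (intro power_mono) auto
  also have "\<dots> = exp (real k * \<epsilon>)" by (simp add: exp_of_nat_mult)
  also have "real k * \<epsilon> \<le> 1" using \<epsilon>_le k_pos by (simp add: field_simps)
  finally show ?thesis by simp
qed

text \<open>The factor \<open>exp 1\<close> in \<epsilon> absorbs \<open>(1 + \<epsilon>)^k\<close>;
  this closes the recursion of \<open>sum_heaps_le\<close>.\<close>

lemma \<epsilon>_fixed_point: "real L * ((1 + \<epsilon>) ^ k / 2 ^ k) \<le> \<epsilon>"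
proof -
  have "real L * ((1 + \<epsilon>) ^ k / 2 ^ k) \<le> real L * (exp 1 / 2 ^ k)"
    using power_\<epsilon>_le by (intro mult_left_mono divide_right_mono) auto
  then show ?thesis by (simp add: \<epsilon>_def mult.commute)
qed

lemma finite_\<Phi>: "finite \<Phi>"
proof (rule finite_subset)
  show "\<Phi> \<subseteq> Pow ({1..n} \<times> UNIV)"
    using instance_ksat by (fastforce simp: ksat_instance_def clause_vars_def)
qed simp

lemma finite_\<Psi>: "finite \<Psi>"
  using finite_\<Phi> by (simp add: \<Psi>_def)

lemma \<Psi>_clause:
  assumes "C \<in> \<Psi>"
  shows "clause_vars C \<subseteq> {1..n}" "card (clause_vars C) = k" "clause_vars C \<noteq> {}" "proper C"
proof -
  show "clause_vars C \<subseteq> {1..n}" "proper C"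
    using assms instance_ksat by (auto simp: \<Psi>_def ksat_instance_def)
  show card: "card (clause_vars C) = k"
    using assms instance_ksat by (simp add: \<Psi>_def ksat_instance_def card_clause_vars)
  then show "clause_vars C \<noteq> {}" using k_pos by auto
qed

lemma violated_in_\<Psi>: "C \<in> violated \<Phi> x \<Longrightarrow> C \<in> \<Psi> \<and> \<not> satisfies x C"
  by (auto simp: violated_def \<Psi>_def violated_imp_proper)

lemma degree_le:
  assumes "i \<in> {1..n}" "\<Psi>' \<subseteq> \<Psi>"
  shows "card {C \<in> \<Psi>'. i \<in> clause_vars C} \<le> L"
proof -
  have "card {C \<in> \<Psi>'. i \<in> clause_vars C} \<le> card {C \<in> \<Phi>. i \<in> clause_vars C}"
    using assms finite_\<Phi> by (intro card_mono) (auto simp: \<Psi>_def)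
  also have "\<dots> \<le> L" using occurrences assms by (simp add: occurrences_at_most_def)
  finally show ?thesis .
qed

lemma sum_heaps_sparse_le:
  assumes "\<Psi>' \<subseteq> \<Psi>" "M \<subseteq> {1..n}"
  shows "(\<Sum>h\<in>heaps \<Psi>' M m. table_prob n h) \<le> (1 + \<epsilon>) ^ card M"
  using assms finite_\<Psi> \<Psi>_clause \<epsilon>_nonneg \<epsilon>_fixed_point degree_le
  by (intro sum_heaps_le[where k = k and L = L]) (auto intro: finite_subset)

lemma runtime_potential_step:
  assumes "C \<in> violated \<Phi> x"
  shows "(\<integral>\<^sup>+x'. ennreal (runtime_potential t x') \<partial>resample C x) + 1
    \<le> ennreal (runtime_potential (Suc t) x)"
proof -
  have C: "C \<in> \<Psi>" "\<not> satisfies x C" using violated_in_\<Psi>[OF assms] by auto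
  let ?I = "\<lambda>B. \<integral>\<^sup>+x'. ennreal (root_sum n \<Psi> (clause_vars B) B t x') \<partial>resample C x"
  have "?I B + (if B = C then 1 else 0) \<le> ennreal (root_sum n \<Psi> (clause_vars B) B (Suc t) x)"
    if "B \<in> \<Psi>" for B
  proof -
    have "(if B = C then 1 else 0)
        \<le> ennreal (if clause_vars C \<inter> clause_vars B = {} then 0 else table_weight n x (falsifier B))"
      using C \<Psi>_clause[OF C(1)] by (auto simp: table_weight_falsifier)
    then show ?thesis
      using root_sum_step[OF finite_\<Psi> C(1) \<Psi>_clause(1,3)[OF C(1)] C(2),
          where R = B and M = "clause_vars B" and m = t]
      by (meson Int_lower2 add_left_mono order_trans)
  qed
  then have "(\<Sum>B\<in>\<Psi>. ?I B + (if B = C then 1 else 0))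
      \<le> (\<Sum>B\<in>\<Psi>. ennreal (root_sum n \<Psi> (clause_vars B) B (Suc t) x))"
    by (rule sum_mono)
  also have "(\<Sum>B\<in>\<Psi>. ?I B + (if B = C then 1 else 0)) = sum ?I \<Psi> + 1"
    using C(1) finite_\<Psi> by (simp add: sum.distrib)
  also have "sum ?I \<Psi> = (\<integral>\<^sup>+x'. ennreal (runtime_potential t x') \<partial>resample C x)"
    unfolding runtime_potential_def
    by (subst nn_integral_sum[symmetric]) (auto simp: sum_ennreal)
  finally show ?thesis by (simp add: runtime_potential_def sum_ennreal)
qed

lemma runtime_potential_avg:
  "(\<integral>\<^sup>+x. ennreal (runtime_potential t x) \<partial>uniform_bits {1..n})
    \<le> ennreal (\<Sum>B\<in>\<Psi>. (1 + \<epsilon>) ^ k / 2 ^ k)"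
proof -
  have "(\<integral>\<^sup>+x. ennreal (runtime_potential t x) \<partial>uniform_bits {1..n})
      = (\<Sum>B\<in>\<Psi>. \<integral>\<^sup>+x. ennreal (root_sum n \<Psi> (clause_vars B) B t x) \<partial>uniform_bits {1..n})"
    unfolding runtime_potential_def
    by (subst nn_integral_sum[symmetric]) (auto simp: sum_ennreal)
  also have "\<dots> \<le> (\<Sum>B\<in>\<Psi>. ennreal ((1 + \<epsilon>) ^ k / 2 ^ k))"
  proof (rule sum_mono)
    fix B assume "B \<in> \<Psi>"
    note B = \<Psi>_clause[OF this]
    show "(\<integral>\<^sup>+x. ennreal (root_sum n \<Psi> (clause_vars B) B t x) \<partial>uniform_bits {1..n})
        \<le> ennreal ((1 + \<epsilon>) ^ k / 2 ^ k)"
      unfolding nn_integral_uniform_root_sum[OF B(1)]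
      using sum_heaps_sparse_le[OF order_refl B(1), of t] B(2)
      by (intro ennreal_leI) (simp add: divide_right_mono)
  qed
  also have "\<dots> = ennreal (\<Sum>B\<in>\<Psi>. (1 + \<epsilon>) ^ k / 2 ^ k)"
    using \<epsilon>_nonneg by (intro sum_ennreal) simp
  finally show ?thesis .
qed

lemma mt_output_supermartingale:
  assumes "valid_rule \<Phi> sel"
    and "\<And>t x. violated \<Phi> x = {} \<Longrightarrow> indicator S (Some x) \<le> F t x"
    and "\<And>t x C. C \<in> violated \<Phi> x \<Longrightarrow> (\<integral>\<^sup>+x'. F t x' \<partial>resample C x) \<le> F (Suc t) x"
    and "\<And>t. (\<integral>\<^sup>+x. F t x \<partial>uniform_bits {1..n}) \<le> ennreal f" and "0 \<le> f"
  shows "measure (measure_pmf (mt_output n \<Phi> sel)) S \<le> f"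
  by (rule mt_output_bound[where F = F and G = "\<lambda>t x. ennreal (runtime_potential t x)"
        and g = "\<Sum>B\<in>\<Psi>. (1 + \<epsilon>) ^ k / 2 ^ k"])
    (use assms runtime_potential_step runtime_potential_avg \<epsilon>_nonneg in \<open>auto intro!: sum_nonneg\<close>)

lemma mt_output_lossless:
  assumes "valid_rule \<Phi> sel"
  shows "lossless_spmf (mt_output n \<Phi> sel)"
proof -
  \<comment> \<open>\<open>None\<close> is not the result of any terminated run, so the zero
    supermartingale dominates this event.\<close>
  have "measure (measure_pmf (mt_output n \<Phi> sel)) {None} \<le> 0"
    by (rule mt_output_supermartingale[OF assms, where F = "\<lambda>_ _. 0"]) auto
  then show ?thesis
    by (simp add: lossless_iff_pmf_None measure_pmf_single antisym)
qed

section \<open>Upper bound for the probability of a prescribed pattern\<close>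

lemma mt_output_event_le:
  assumes rule: "valid_rule \<Phi> sel"
    and E: "proper E" "clause_vars E \<subseteq> {1..n}"
  shows "measure (measure_pmf (mt_output n \<Phi> sel)) (Some ` {x. \<not> satisfies x E})
    \<le> 1 / 2 ^ card (clause_vars E) + \<epsilon>"
proof -
  let ?j = "card (clause_vars E)"
  \<comment> \<open>\<open>E\<close> serves as the root although it need not be a clause of
    \<open>\<Phi>\<close>; the empty heap below it dominates the event.\<close>
  have "measure (measure_pmf (mt_output n \<Phi> sel)) (Some ` {x. \<not> satisfies x E}) \<le> (1 + \<epsilon>) ^ ?j / 2 ^ ?j"
  proof (rule mt_output_supermartingale[OF rule,
        where F = "\<lambda>t x. ennreal (root_sum n \<Psi> (clause_vars E) E t x)"])
    fix t x
    show "indicator (Some ` {x. \<not> satisfies x E}) (Some x)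
        \<le> ennreal (root_sum n \<Psi> (clause_vars E) E t x)"
      using root_sum_ge_indicator[OF finite_\<Psi> _ E(2)] by (auto simp: indicator_def)
  next
    fix t x C assume "C \<in> violated \<Phi> x"
    then have C: "C \<in> \<Psi>" "\<not> satisfies x C" using violated_in_\<Psi> by auto
    show "(\<integral>\<^sup>+x'. ennreal (root_sum n \<Psi> (clause_vars E) E t x') \<partial>resample C x)
        \<le> ennreal (root_sum n \<Psi> (clause_vars E) E (Suc t) x)"
      using C \<Psi>_clause[OF C(1)] by (intro root_sum_supermartingale finite_\<Psi>) auto
  next
    fix t
    show "(\<integral>\<^sup>+x. ennreal (root_sum n \<Psi> (clause_vars E) E t x) \<partial>uniform_bits {1..n})
        \<le> ennreal ((1 + \<epsilon>) ^ ?j / 2 ^ ?j)"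
      unfolding nn_integral_uniform_root_sum[OF E(2)]
      using sum_heaps_sparse_le[OF order_refl E(2), of t]
      by (intro ennreal_leI) (simp add: divide_right_mono)
  qed (use \<epsilon>_nonneg in auto)
  also have "(1 + \<epsilon>) ^ ?j / 2 ^ ?j \<le> (1 + (2 ^ ?j - 1) * \<epsilon>) / 2 ^ ?j"
    using power_one_plus_le[OF \<epsilon>_nonneg \<epsilon>_le_1] by (rule divide_right_mono) simp
  also have "\<dots> \<le> 1 / 2 ^ ?j + \<epsilon>"
    using \<epsilon>_nonneg by (simp add: field_simps)
  finally show ?thesis .
qed

section \<open>Lower bound, through the first clause that hits the event\<close>

text \<open>If \<open>E\<close> is violated initially but satisfied in the end, then consider the first resampled
  clause \<open>B\<close> that shares a variable with \<open>E\<close>. At that time both \<open>B\<close> and \<open>E\<close> are violated, and all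
  clauses below \<open>B\<close> in its heap are disjoint from \<open>E\<close>.\<close>

definition compatible :: "clause \<Rightarrow> clause set" where
  "compatible E = {B \<in> \<Psi>. clause_vars B \<inter> clause_vars E \<noteq> {} \<and> proper (B \<union> E)}"

definition apart :: "clause \<Rightarrow> clause set" where
  "apart E = {C \<in> \<Psi>. clause_vars C \<inter> clause_vars E = {}}"

text \<open>The joint root \<open>B \<union> E\<close> expresses that \<open>B\<close> and
  \<open>E\<close> are violated at the same time.\<close>

definition hit_sum :: "clause \<Rightarrow> nat \<Rightarrow> assignment \<Rightarrow> real" where
  "hit_sum E t x = (\<Sum>B\<in>compatible E. root_sum n (apart E) (clause_vars B) (B \<union> E) t x)"

lemma clause_vars_Un: "clause_vars (B \<union> E) = clause_vars B \<union> clause_vars E"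
  by (auto simp: clause_vars_def)

lemma satisfies_Un: "satisfies x (B \<union> E) \<longleftrightarrow> satisfies x B \<or> satisfies x E"
  by (auto simp: satisfies_def)

lemma finite_compatible: "finite (compatible E)"
  using finite_\<Psi> by (simp add: compatible_def)

lemma finite_apart: "finite (apart E)"
  using finite_\<Psi> by (simp add: apart_def)

lemma hit_sum_nonneg [simp]: "0 \<le> hit_sum E t x"
  by (simp add: hit_sum_def sum_nonneg)

lemma hit_sum_ge_1:
  assumes "C \<in> \<Psi>" "clause_vars C \<inter> clause_vars E \<noteq> {}" "\<not> satisfies x C" "\<not> satisfies x E"
    and E: "clause_vars E \<subseteq> {1..n}"
  shows "1 \<le> hit_sum E t x"
proof -
  have unsat: "\<not> satisfies x (C \<union> E)" using assms by (simp add: satisfies_Un)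
  then have "C \<in> compatible E"
    using assms by (simp add: compatible_def violated_imp_proper)
  then have "root_sum n (apart E) (clause_vars C) (C \<union> E) t x \<le> hit_sum E t x"
    unfolding hit_sum_def by (intro member_le_sum finite_compatible) auto
  moreover have "1 \<le> root_sum n (apart E) (clause_vars C) (C \<union> E) t x"
    using \<Psi>_clause(1)[OF assms(1)] E
    by (intro root_sum_ge_indicator[OF finite_apart unsat]) (simp add: clause_vars_Un)
  ultimately show ?thesis by simp
qed

text \<open>A clause disjoint from \<open>E\<close> meets the root \<open>B \<union> E\<close> only
  in \<open>B\<close>, as the supermartingale property requires for the smaller set
  \<open>clause_vars B\<close>.\<close>

lemma hit_sum_step:
  assumes C: "C \<in> apart E" "\<not> satisfies x C"
  shows "(\<integral>\<^sup>+x'. ennreal (hit_sum E t x') \<partial>resample C x) \<le> ennreal (hit_sum E (Suc t) x)"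
proof -
  have C': "C \<in> \<Psi>" "clause_vars C \<inter> clause_vars E = {}" using C by (auto simp: apart_def)
  have "(\<integral>\<^sup>+x'. ennreal (hit_sum E t x') \<partial>resample C x)
      = (\<Sum>B\<in>compatible E. \<integral>\<^sup>+x'. ennreal (root_sum n (apart E) (clause_vars B) (B \<union> E) t x') \<partial>resample C x)"
    unfolding hit_sum_def by (subst nn_integral_sum[symmetric]) (auto simp: sum_ennreal)
  also have "\<dots> \<le> (\<Sum>B\<in>compatible E. ennreal (root_sum n (apart E) (clause_vars B) (B \<union> E) (Suc t) x))"
  proof (rule sum_mono)
    fix B assume "B \<in> compatible E"
    have "clause_vars C \<inter> clause_vars (B \<union> E) \<subseteq> clause_vars B"
      using C' by (auto simp: clause_vars_Un)
    then show "(\<integral>\<^sup>+x'. ennreal (root_sum n (apart E) (clause_vars B) (B \<union> E) t x') \<partial>resample C x)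
        \<le> ennreal (root_sum n (apart E) (clause_vars B) (B \<union> E) (Suc t) x)"
      using C \<Psi>_clause[OF C'(1)] by (intro root_sum_supermartingale finite_apart)
  qed
  finally show ?thesis by (simp add: hit_sum_def sum_ennreal)
qed

text \<open>Double counting: if \<open>B\<close> shares \<open>s\<close> of the \<open>j\<close>
  variables of \<open>E\<close>, its term \<open>2^(s-j)\<close> is at most \<open>s / j\<close>,
  and the numbers \<open>s\<close> add up to at most \<open>j * L\<close> incidences.\<close>

lemma sum_compatible_le:
  assumes E: "clause_vars E \<subseteq> {1..n}" "clause_vars E \<noteq> {}"
  shows "(\<Sum>B\<in>compatible E. 2 ^ card (clause_vars B \<inter> clause_vars E) / 2 ^ card (clause_vars E)) \<le> real L"
proof -
  let ?V = "clause_vars E"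
  have fin: "finite ?V" using E finite_subset by blast
  then have j: "0 < card ?V" using E by (simp add: card_gt_0_iff)
  have "2 ^ card (clause_vars B \<inter> ?V) / 2 ^ card ?V \<le> real (card (clause_vars B \<inter> ?V)) / real (card ?V)"
    if "B \<in> compatible E" for B
  proof -
    have "1 \<le> card (clause_vars B \<inter> ?V)" "card (clause_vars B \<inter> ?V) \<le> card ?V"
      using that fin by (auto simp: compatible_def card_gt_0_iff Suc_le_eq intro!: card_mono)
    from mult_power2_le[OF this]
    have "real (card ?V * 2 ^ card (clause_vars B \<inter> ?V)) \<le> real (card (clause_vars B \<inter> ?V) * 2 ^ card ?V)"
      by (rule of_nat_mono)
    with j show ?thesis by (simp add: field_simps)
  qed
  then have "(\<Sum>B\<in>compatible E. 2 ^ card (clause_vars B \<inter> ?V) / 2 ^ card ?V)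
      \<le> (\<Sum>B\<in>compatible E. real (card (clause_vars B \<inter> ?V)) / real (card ?V))"
    by (rule sum_mono)
  also have "\<dots> = real (\<Sum>B\<in>compatible E. card (clause_vars B \<inter> ?V)) / real (card ?V)"
    by (simp add: sum_divide_distrib)
  also have "(\<Sum>B\<in>compatible E. card (clause_vars B \<inter> ?V))
      = (\<Sum>B\<in>compatible E. \<Sum>i\<in>?V. of_bool (i \<in> clause_vars B))"
    using fin by (simp add: Int_commute)
  also have "\<dots> = (\<Sum>i\<in>?V. \<Sum>B\<in>compatible E. of_bool (i \<in> clause_vars B))"
    by (rule sum.swap)
  also have "\<dots> = (\<Sum>i\<in>?V. card {B \<in> compatible E. i \<in> clause_vars B})"
    using finite_compatible by (intro sum.cong) (auto simp: Int_def)
  also have "\<dots> \<le> (\<Sum>i\<in>?V. L)"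
    using E by (intro sum_mono degree_le) (auto simp: compatible_def)
  finally show ?thesis using j by (simp add: field_simps)
qed

text \<open>With \<open>s\<close> shared variables the root \<open>B \<union> E\<close> has
  \<open>k + j - s\<close> variables, while its heaps grow only from the \<open>k\<close> variables
  of \<open>B\<close>. Summing over \<open>B\<close> leaves at most
  \<open>L * 2^(-k) * (1 + \<epsilon>)^k\<close>.\<close>

lemma hit_sum_avg:
  assumes E: "clause_vars E \<subseteq> {1..n}" "clause_vars E \<noteq> {}"
  shows "(\<integral>\<^sup>+x. ennreal (hit_sum E t x) \<partial>uniform_bits {1..n}) \<le> ennreal \<epsilon>"
proof -
  let ?V = "clause_vars E"
  let ?c = "\<lambda>B. (1 + \<epsilon>) ^ k / 2 ^ k * (2 ^ card (clause_vars B \<inter> ?V) / 2 ^ card ?V)"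
  have "(\<integral>\<^sup>+x. ennreal (hit_sum E t x) \<partial>uniform_bits {1..n})
      = (\<Sum>B\<in>compatible E. \<integral>\<^sup>+x. ennreal (root_sum n (apart E) (clause_vars B) (B \<union> E) t x) \<partial>uniform_bits {1..n})"
    unfolding hit_sum_def by (subst nn_integral_sum[symmetric]) (auto simp: sum_ennreal)
  also have "\<dots> \<le> (\<Sum>B\<in>compatible E. ennreal (?c B))"
  proof (rule sum_mono)
    fix B assume "B \<in> compatible E"
    then have "B \<in> \<Psi>" by (simp add: compatible_def)
    note B = \<Psi>_clause[OF this]
    have vars: "clause_vars (B \<union> E) \<subseteq> {1..n}" using B E by (simp add: clause_vars_Un)
    have "finite (clause_vars B)" "finite ?V" using B E finite_subset by blast+
    then have "card (clause_vars (B \<union> E)) + card (clause_vars B \<inter> ?V) = k + card ?V"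
      using card_Un_Int[of "clause_vars B" ?V] B(2) by (simp add: clause_vars_Un)
    then have "2 ^ card (clause_vars (B \<union> E)) * 2 ^ card (clause_vars B \<inter> ?V) = (2::real) ^ k * 2 ^ card ?V"
      by (simp flip: power_add)
    then have c: "?c B = (1 + \<epsilon>) ^ k / 2 ^ card (clause_vars (B \<union> E))"
      by (simp add: field_simps)
    show "(\<integral>\<^sup>+x. ennreal (root_sum n (apart E) (clause_vars B) (B \<union> E) t x) \<partial>uniform_bits {1..n})
        \<le> ennreal (?c B)"
      unfolding nn_integral_uniform_root_sum[OF vars] c
      using sum_heaps_sparse_le[of "apart E", OF _ B(1), of t] B(2)
      by (intro ennreal_leI divide_right_mono) (auto simp: apart_def)
  qed
  also have "\<dots> = ennreal (sum ?c (compatible E))"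
    using \<epsilon>_nonneg by (simp add: sum_ennreal)
  also have "sum ?c (compatible E)
      = (1 + \<epsilon>) ^ k / 2 ^ k * (\<Sum>B\<in>compatible E. 2 ^ card (clause_vars B \<inter> ?V) / 2 ^ card ?V)"
    by (rule sum_distrib_left[symmetric])
  also have "\<dots> \<le> (1 + \<epsilon>) ^ k / 2 ^ k * real L"
    using \<epsilon>_nonneg by (intro mult_left_mono sum_compatible_le E) auto
  also have "\<dots> \<le> \<epsilon>" using \<epsilon>_fixed_point by (simp add: mult.commute)
  finally show ?thesis by (simp add: ennreal_leI)
qed

lemma mt_output_complement_le:
  assumes rule: "valid_rule \<Phi> sel"
    and E: "proper E" "clause_vars E \<subseteq> {1..n}" "clause_vars E \<noteq> {}"
  shows "measure (measure_pmf (mt_output n \<Phi> sel)) (Some ` {x. satisfies x E})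
    \<le> 1 - 1 / 2 ^ card (clause_vars E) + \<epsilon>"
proof -
  let ?p = "1 / 2 ^ card (clause_vars E) :: real"
  \<comment> \<open>While \<open>E\<close> is violated, \<open>F\<close> charges the heaps of a
    clause that will hit \<open>E\<close>. The cap at 1 covers the hit itself: there
    \<open>hit_sum\<close> is at least 1, whatever the resampling does to \<open>E\<close>.\<close>
  define F where "F t x = (if satisfies x E then 1 else min 1 (ennreal (hit_sum E t x)))" for t x
  show ?thesis
  proof (rule mt_output_supermartingale[OF rule, where F = F])
    fix t x
    show "indicator (Some ` {x. satisfies x E}) (Some x) \<le> F t x"
      by (auto simp: F_def indicator_def)
  next
    fix t x C assume "C \<in> violated \<Phi> x"
    then have C: "C \<in> \<Psi>" "\<not> satisfies x C" using violated_in_\<Psi> by auto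
    have "(\<integral>\<^sup>+x'. F t x' \<partial>resample C x) \<le> (\<integral>\<^sup>+x'. 1 \<partial>resample C x)"
      by (rule nn_integral_mono) (auto simp: F_def)
    then have le_1: "(\<integral>\<^sup>+x'. F t x' \<partial>resample C x) \<le> 1" by simp
    consider (sat) "satisfies x E" | (hit) "\<not> satisfies x E" "clause_vars C \<inter> clause_vars E \<noteq> {}"
      | (apart) "\<not> satisfies x E" "clause_vars C \<inter> clause_vars E = {}" by blast
    then show "(\<integral>\<^sup>+x'. F t x' \<partial>resample C x) \<le> F (Suc t) x"
    proof cases
      case sat
      then show ?thesis using le_1 by (simp add: F_def)
    next
      case hit
      then have "1 \<le> ennreal (hit_sum E (Suc t) x)"
        using hit_sum_ge_1[OF C(1) _ C(2) _ E(2)] by simp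
      then show ?thesis using le_1 hit by (simp add: F_def min_def)
    next
      case apart
      \<comment> \<open>Resampling a clause disjoint from \<open>E\<close> keeps \<open>E\<close>
        violated, so only the \<open>hit_sum\<close> branch of \<open>F\<close> matters.\<close>
      have "\<not> satisfies x' E" if "x' \<in> set_pmf (resample C x)" for x'
      proof -
        from that obtain y where x': "x' = override_on x y (clause_vars C)"
          by (auto simp: resample_def)
        have "x' i = x i" if "i \<in> clause_vars E" for i
          using that apart(2) unfolding x' by (intro override_on_apply_notin) blast
        with apart(1) show ?thesis by (simp add: violates_iff[OF E(1)])
      qed
      then have "(\<integral>\<^sup>+x'. F t x' \<partial>resample C x) \<le> (\<integral>\<^sup>+x'. ennreal (hit_sum E t x') \<partial>resample C x)"
        by (intro nn_integral_mono_AE) (auto simp: AE_measure_pmf_iff F_def)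
      also have "\<dots> \<le> ennreal (hit_sum E (Suc t) x)"
        using C apart by (intro hit_sum_step) (auto simp: apart_def)
      finally show ?thesis using le_1 apart by (simp add: F_def)
    qed
  next
    fix t
    \<comment> \<open>This is \<open>F \<le> 1 - [E violated] + hit_sum\<close>, written as a sum
      because subtraction in \<open>ennreal\<close> is truncated.\<close>
    have pointwise: "F t x + ennreal (table_weight n x (falsifier E)) \<le> 1 + ennreal (hit_sum E t x)" for x
      using E by (auto simp: F_def table_weight_falsifier add.commute intro!: add_mono)
    have "(\<integral>\<^sup>+x. F t x \<partial>uniform_bits {1..n}) + ennreal ?p
        = (\<integral>\<^sup>+x. F t x + ennreal (table_weight n x (falsifier E)) \<partial>uniform_bits {1..n})"
      by (simp only: table_prob_falsifier[OF E(2), symmetric] nn_integral_uniform_table_weight[symmetric])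
        (rule nn_integral_add[symmetric]; simp)
    also have "\<dots> \<le> (\<integral>\<^sup>+x. 1 + ennreal (hit_sum E t x) \<partial>uniform_bits {1..n})"
      by (rule nn_integral_mono) (rule pointwise)
    also have "\<dots> = 1 + (\<integral>\<^sup>+x. ennreal (hit_sum E t x) \<partial>uniform_bits {1..n})"
      by (subst nn_integral_add) auto
    also have "\<dots> \<le> 1 + ennreal \<epsilon>"
      by (intro add_left_mono hit_sum_avg E)
    also have "\<dots> = ennreal (1 + \<epsilon> - ?p) + ennreal ?p"
    proof -
      have "?p \<le> 1" by (simp add: divide_le_eq)
      then have "0 \<le> 1 + \<epsilon> - ?p" using \<epsilon>_nonneg by linarith
      then have "ennreal (1 + \<epsilon> - ?p) + ennreal ?p = ennreal (1 + \<epsilon>)"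
        by (subst ennreal_plus[symmetric]) auto
      then show ?thesis using \<epsilon>_nonneg by simp
    qed
    finally show "(\<integral>\<^sup>+x. F t x \<partial>uniform_bits {1..n}) \<le> ennreal (1 - ?p + \<epsilon>)"
      by (simp add: add.commute add_diff_eq)
  qed (use \<epsilon>_nonneg in \<open>auto simp: divide_le_eq\<close>)
qed

end

section \<open>Both bounds applied to \<open>j\<close> prescribed bits\<close>

theorem theorem5p1:
  fixes n k L j :: nat and \<Phi> :: "clause set" and sel :: selection_rule
  assumes "ksat_instance n k \<Phi>"
    and "occurrences_at_most n L \<Phi>"
    and "real L \<le> 2 ^ k / (exp 1 * real k)"
    and "1 \<le> j" and "j \<le> k"
    and "valid_rule \<Phi> sel"
  shows "\<exists>D. is_mt_distribution n \<Phi> sel D \<and>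
           approx_jwise_independent n j (exp 1 * real L / 2 ^ k) D"
proof -
  interpret sparse_ksat n k L \<Phi>
    by unfold_locales (use assms in auto)
  from mt_output_lossless[OF assms(6)] obtain D where D: "mt_output n \<Phi> sel = spmf_of_pmf D"
    by (auto simp: lossless_spmf_conv_spmf_of_pmf)
  have prob: "measure_pmf.prob D A = measure (measure_pmf (mt_output n \<Phi> sel)) (Some ` A)" for A
    by (simp add: D spmf_of_pmf_def measure_map_pmf inj_vimage_image_eq)
  have "\<bar>measure_pmf.prob D {x. \<forall>l\<in>{1..j}. x (i l) = y l} - 1 / 2 ^ j\<bar> \<le> \<epsilon>"
    if i: "strict_mono_on {1..j} i" "i ` {1..j} \<subseteq> {1..n}" for i y
  proof -
    \<comment> \<open>The literals are negated so that the event becomes the violation of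
      \<open>E\<close>.\<close>
    define E where "E = (\<lambda>l. (i l, \<not> y l)) ` {1..j}"
    have inj: "inj_on i {1..j}" using i(1) by (rule strict_mono_on_imp_inj_on)
    have vars: "clause_vars E = i ` {1..j}" by (auto simp: clause_vars_def E_def image_image)
    have card: "card (clause_vars E) = j" using inj by (simp add: vars card_image)
    have E: "proper E" "clause_vars E \<subseteq> {1..n}" "clause_vars E \<noteq> {}"
    proof -
      show "proper E"
        unfolding proper_def
      proof (intro allI notI)
        fix v assume "(v, True) \<in> E \<and> (v, False) \<in> E"
        then obtain l l' where "l \<in> {1..j}" "l' \<in> {1..j}" "v = i l" "v = i l'" "\<not> y l" "y l'"
          unfolding E_def by blast
        then show False using inj_onD[OF inj, of l l'] by auto
      qed
    qed (use i(2) assms(4) in \<open>simp_all add: vars\<close>)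
    have event: "{x. \<forall>l\<in>{1..j}. x (i l) = y l} = {x. \<not> satisfies x E}"
      by (auto simp: satisfies_def E_def)
    have "measure_pmf.prob D {x. \<not> satisfies x E} \<le> 1 / 2 ^ j + \<epsilon>"
      using mt_output_event_le[OF assms(6) E(1,2)] by (simp add: prob card)
    \<comment> \<open>As \<open>D\<close> has total mass one, this bound on the complement yields
      the lower bound.\<close>
    moreover have "measure_pmf.prob D {x. satisfies x E} \<le> 1 - 1 / 2 ^ j + \<epsilon>"
      using mt_output_complement_le[OF assms(6) E] by (simp add: prob card)
    moreover have "measure_pmf.prob D {x. satisfies x E} = 1 - measure_pmf.prob D {x. \<not> satisfies x E}"
      using measure_pmf.prob_compl[of "{x. \<not> satisfies x E}" D] by (simp add: Compl_eq_Diff_UNIV[symmetric] Collect_neg_eq[symmetric])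
    ultimately show ?thesis unfolding event by linarith
  qed
  then show ?thesis
    using D unfolding is_mt_distribution_def approx_jwise_independent_def \<epsilon>_def by blast
qed

end
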